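(* Let $\mathbf{u}_k(t)$ ($k=1,\ldots,n_g$), $\mathbf{Q}_\beta(t)$, $\mathbf{P}_\beta(t)$ ($\beta=1,\ldots,n_p$), $t\in[0,1]$, be a solution, with values in $\mathbb{R}^2$, of the semi-discrete equations $$\frac{\partial}{\partial\mathbf{u}_k}\frac12\|\mathbf{u}\|_g^2=\sum_{\beta=1}^{n_p}\mathbf{P}_\beta\psi_k(\mathbf{Q}_\beta),\qquad k=1,\ldots,n_g,$$ $$\dot{\mathbf{Q}}_\beta=\sum_{k=1}^{n_g}\mathbf{u}_k\psi_k(\mathbf{Q}_\beta),\qquad \dot{\mathbf{P}}_\beta=-\mathbf{P}_\beta\cdot\sum_{k=1}^{n_g}\mathbf{u}_k\nabla\psi_k(\mathbf{Q}_\beta),\qquad \beta=1,\ldots,n_p,$$ and let $J_\beta(t)$ be the $2\times2$ matrix-valued solution of $$\dot J_\beta=\Big(\sum_{k=1}^{n_g}\mathbf{u}_k\nabla\psi_k(\mathbf{Q}_\beta)\Big)J_\beta,\qquad J_\beta(0)=\mathrm{Id}.$$ Then for each $\beta=1,\ldots,n_p$ the quantity $J_\beta^T\mathbf{P}_\beta$ is conserved, i.e. $J_\beta(t)^T\mathbf{P}_\beta(t)$ is independent of $t\in[0,1]$.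
   Context: Setting: $n_g$ and $n_p$ are positive integers. The functions $\psi_k:\mathbb{R}^2\to\mathbb{R}$, $k=1,\ldots,n_g$, are fixed basis functions (assumed continuously differentiable) attached to mesh points $\mathbf{x}_k$; a mesh velocity $\mathbf{u}=(\mathbf{u}_1,\ldots,\mathbf{u}_{n_g})\in(\mathbb{R}^2)^{n_g}$ represents the vector field $\mathbf{u}(\mathbf{x})=\sum_k\mathbf{u}_k\psi_k(\mathbf{x})$. $\|\cdot\|_g^2$ is a fixed discretised squared norm on $(\mathbb{R}^2)^{n_g}$ (a positive-definite quadratic form). Notation: $\mathbf{u}_k\nabla\psi_k(\mathbf{x})$ is the $2\times2$ matrix with $(i,j)$ entry $(\mathbf{u}_k)_i\,\partial\psi_k/\partial x_j(\mathbf{x})$, so that $\sum_k\mathbf{u}_k\nabla\psi_k$ is the Jacobian matrix of the vector field $\sum_k\mathbf{u}_k\psi_k$. For a vector $\mathbf{P}$ and a matrix $M$, $\mathbf{P}\cdot M$ denotes $M^T\mathbf{P}$; thus $\mathbf{P}_\beta\cdot\sum_k\mathbf{u}_k\nabla\psi_k=\sum_k(\mathbf{P}_\beta\cdot\mathbf{u}_k)\nabla\psi_k$. $J_\beta(t)$ is the Jacobian $\partial\mathbf{g}/\partial\mathbf{x}$ at $\mathbf{Q}_\beta(0)$ of the flow map $\mathbf{g}(\cdot,t)$ of the vector field $\sum_k\mathbf{u}_k\psi_k$. *)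

theory Defs
  imports "HOL-Analysis.Analysis"
begin

definition partial_deriv :: "'n::finite \<Rightarrow> (real^'n \<Rightarrow> real) \<Rightarrow> real^'n \<Rightarrow> real" where
  "partial_deriv j f x = deriv (\<lambda>h. f (x + h *\<^sub>R axis j 1)) 0"

definition gradient :: "(real^'n::finite \<Rightarrow> real) \<Rightarrow> real^'n \<Rightarrow> real^'n" where
  "gradient f x = (\<chi> j. partial_deriv j f x)"

definition cont_differentiable :: "(real^'n::finite \<Rightarrow> real) \<Rightarrow> bool" where
  "cont_differentiable f \<longleftrightarrow>
     (\<forall>x. f differentiable (at x)) \<and> (\<forall>j. continuous_on UNIV (partial_deriv j f))"

definition pos_def_quadratic_form :: "('v::real_vector \<Rightarrow> real) \<Rightarrow> bool" where
  "pos_def_quadratic_form N \<longleftrightarrow>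
     (\<exists>B. bilinear B \<and> (\<forall>u v. B u v = B v u) \<and> (\<forall>u. N u = B u u)) \<and>
     (\<forall>u. u \<noteq> 0 \<longrightarrow> N u > 0)"

text \<open>The derivative with respect to the vector \<open>u\<^sub>k\<close>, all other blocks \<open>u\<^sub>l\<close> being held fixed.\<close>

definition block_gradient ::
    "'g::finite \<Rightarrow> ((real^'n::finite)^'g \<Rightarrow> real) \<Rightarrow> (real^'n)^'g \<Rightarrow> real^'n" where
  "block_gradient k F u = gradient (\<lambda>v. F (\<chi> l. if l = k then v else u $ l)) (u $ k)"

definition velocity_field ::
    "('g::finite \<Rightarrow> real^'n::finite \<Rightarrow> real) \<Rightarrow> (real^'n)^'g \<Rightarrow> real^'n \<Rightarrow> real^'n" where
  "velocity_field \<psi> u x = (\<Sum>k\<in>UNIV. \<psi> k x *\<^sub>R u $ k)"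

definition outer_product :: "real^'m::finite \<Rightarrow> real^'n::finite \<Rightarrow> real^'n^'m" where
  "outer_product a b = (\<chi> i j. a $ i * b $ j)"

definition velocity_jacobian ::
    "('g::finite \<Rightarrow> real^'n::finite \<Rightarrow> real) \<Rightarrow> (real^'n)^'g \<Rightarrow> real^'n \<Rightarrow> real^'n^'n" where
  "velocity_jacobian \<psi> u x = (\<Sum>k\<in>UNIV. outer_product (u $ k) (gradient (\<psi> k) x))"

lemma partial_deriv_eq:
  assumes "(f has_derivative f') (at x)"
  shows "partial_deriv j f x = f' (axis j 1)"
proof -
  have "((\<lambda>h. x + h *\<^sub>R axis j 1) has_derivative (\<lambda>h. h *\<^sub>R axis j 1)) (at (0::real))"
    by (auto intro!: derivative_eq_intros)
  moreover have "(f has_derivative f') (at (x + (0::real) *\<^sub>R axis j 1))"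
    using assms by simp
  ultimately have
    "((\<lambda>h. f (x + h *\<^sub>R axis j 1)) has_derivative (\<lambda>h. f' (h *\<^sub>R axis j 1))) (at (0::real))"
    by (rule has_derivative_compose)
  moreover have "(\<lambda>h. f' (h *\<^sub>R axis j 1)) = (*) (f' (axis j 1))"
    using has_derivative_linear[OF assms] by (simp add: linear_cmul fun_eq_iff)
  ultimately show ?thesis
    unfolding partial_deriv_def by (intro DERIV_imp_deriv) (simp add: has_field_derivative_def)
qed

lemma gradient_eq:
  fixes f :: "real^'n::finite \<Rightarrow> real"
  assumes "GDERIV f x :> D"
  shows "gradient f x = D"
  using partial_deriv_eq[OF assms[unfolded gderiv_def]]
  by (simp add: gradient_def vec_eq_iff inner_axis')

lemma velocity_field_has_derivative:
  assumes "\<And>k. \<psi> k differentiable (at x)"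
  shows "(velocity_field \<psi> u has_derivative (*v) (velocity_jacobian \<psi> u x)) (at x)"
proof -
  have d: "(\<psi> k has_derivative (\<lambda>h. gradient (\<psi> k) x \<bullet> h)) (at x)" for k
  proof -
    obtain f' where f': "(\<psi> k has_derivative f') (at x)"
      using assms by (auto simp: differentiable_def)
    then have lin: "linear f'" by (rule has_derivative_linear)
    have "f' h = gradient (\<psi> k) x \<bullet> h" for h
    proof -
      have "f' h = f' (\<Sum>j\<in>UNIV. h $ j *\<^sub>R axis j 1)"
        using basis_expansion[of h] by (simp add: scalar_mult_eq_scaleR)
      also have "\<dots> = (\<Sum>j\<in>UNIV. h $ j * f' (axis j 1))"
        by (simp add: linear_sum[OF lin] linear_cmul[OF lin])
      finally show ?thesis
        by (simp add: inner_vec_def gradient_def partial_deriv_eq[OF f'] mult.commute)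
    qed
    with f' show ?thesis by (metis (no_types, lifting) ext)
  qed
  have "(velocity_field \<psi> u has_derivative
      (\<lambda>h. \<Sum>k\<in>UNIV. (gradient (\<psi> k) x \<bullet> h) *\<^sub>R u $ k)) (at x)"
    unfolding velocity_field_def by (intro has_derivative_sum has_derivative_scaleR_left d)
  moreover have "(\<Sum>k\<in>UNIV. (gradient (\<psi> k) x \<bullet> h) *\<^sub>R u $ k) = velocity_jacobian \<psi> u x *v h" for h
    by (simp add: vec_eq_iff velocity_jacobian_def outer_product_def matrix_vector_mult_def
        inner_vec_def sum_distrib_right sum_distrib_left mult_ac)
      (subst sum.swap, simp add: mult_ac)
  ultimately show ?thesis by simp
qed

end

theory Submission
  imports Defs
begin

text \<open>Along a fixed trajectory \<open>Q \<beta>\<close>, the velocity Jacobian is a matrix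
  function A(t) of time alone. \<open>J \<beta>\<close> solves the linear equation J' = A J, and
  \<open>P \<beta>\<close> solves its adjoint P' = -A^T P. By the product rule, (J^T P)' = (A J)^T P
  - J^T A^T P = 0, so J^T P is constant on the interval. This cancellation is
  \<open>adjoint_system_invariant\<close>; the product rule comes from the bilinearity
  lemma.\<close>

text \<open>Supplies the product rule for J^T P. In finite dimension bilinearity already gives
  boundedness, so only linearity in each argument has to be checked.\<close>

lemma bounded_bilinear_transpose_matrix_vector_mult:
  "bounded_bilinear (\<lambda>(A::real^'n::finite^'m::finite) x. transpose A *v x)"
  unfolding bilinear_conv_bounded_bilinear[symmetric] bilinear_def
proof (intro conjI allI matrix_vector_mul_linear)
  show "linear (\<lambda>A::real^'n^'m. transpose A *v x)" for x
    by (rule linearI)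
      (simp_all add: vec_eq_iff transpose_def matrix_vector_mult_def sum.distrib
        sum_distrib_left distrib_right mult.assoc)
qed

text \<open>The pairing of a linear flow with its adjoint has zero derivative, and convexity of
  \<open>S\<close> turns this into constancy. Derivatives are taken within \<open>S\<close>, hence
  one-sided at the endpoints of an interval.\<close>

lemma adjoint_system_invariant:
  fixes J :: "real \<Rightarrow> real^'m::finite^'n::finite" and P :: "real \<Rightarrow> real^'n"
  assumes "convex S"
    and P: "\<And>t. t \<in> S \<Longrightarrow> (P has_vector_derivative - (transpose (A t) *v P t)) (at t within S)"
    and J: "\<And>t. t \<in> S \<Longrightarrow> (J has_vector_derivative A t ** J t) (at t within S)"
  shows "(\<lambda>t. transpose (J t) *v P t) constant_on S"
proof -
  have "((\<lambda>t. transpose (J t) *v P t) has_vector_derivative 0) (at t within S)" if "t \<in> S" for t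
  proof -
    \<comment> \<open>\<open>?D\<close> is the product-rule expression. Transposition reverses
      products, (A J)^T = J^T A^T, so its two terms cancel.\<close>
    have "transpose (J t) *v (- (transpose (A t) *v P t)) + transpose (A t ** J t) *v P t = 0"
      (is "?D = 0")
      by (simp only: linear_neg[OF matrix_vector_mul_linear] matrix_transpose_mul
          matrix_vector_mul_assoc left_minus)
    moreover have "((\<lambda>t. transpose (J t) *v P t) has_vector_derivative ?D) (at t within S)"
      by (rule bounded_bilinear.has_vector_derivative
          [OF bounded_bilinear_transpose_matrix_vector_mult J[OF that] P[OF that]])
    ultimately show ?thesis
      by (simp only:)
  qed
  then obtain c where "\<And>t. t \<in> S \<Longrightarrow> transpose (J t) *v P t = c"
    by (rule has_vector_derivative_zero_constant[OF \<open>convex S\<close>]) (assumption, rule that, simp)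
  then show ?thesis
    by (auto simp: constant_on_def)
qed

theorem proposition4:
  fixes \<psi> :: "'g::finite \<Rightarrow> real^2 \<Rightarrow> real"
    and normsq :: "(real^2)^'g \<Rightarrow> real"
    and u :: "real \<Rightarrow> (real^2)^'g"
    and Q P :: "'p::finite \<Rightarrow> real \<Rightarrow> real^2"
    and J :: "'p \<Rightarrow> real \<Rightarrow> real^2^2"
  assumes "\<And>k. cont_differentiable (\<psi> k)"
    and "pos_def_quadratic_form normsq"
    and "\<And>k t. t \<in> {0..1} \<Longrightarrow>
      block_gradient k (\<lambda>v. 1/2 * normsq v) (u t) = (\<Sum>\<beta>\<in>UNIV. \<psi> k (Q \<beta> t) *\<^sub>R P \<beta> t)"
    and "\<And>\<beta> t. t \<in> {0..1} \<Longrightarrow>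
      (Q \<beta> has_vector_derivative velocity_field \<psi> (u t) (Q \<beta> t)) (at t within {0..1})"
    and "\<And>\<beta> t. t \<in> {0..1} \<Longrightarrow>
      (P \<beta> has_vector_derivative - (transpose (velocity_jacobian \<psi> (u t) (Q \<beta> t)) *v P \<beta> t))
        (at t within {0..1})"
    and "\<And>\<beta> t. t \<in> {0..1} \<Longrightarrow>
      (J \<beta> has_vector_derivative velocity_jacobian \<psi> (u t) (Q \<beta> t) ** J \<beta> t)
        (at t within {0..1})"
    and "\<And>\<beta>. J \<beta> 0 = mat 1"
  shows "\<forall>\<beta>. (\<lambda>t. transpose (J \<beta> t) *v P \<beta> t) constant_on {0..1}"
proof
  fix \<beta>
  show "(\<lambda>t. transpose (J \<beta> t) *v P \<beta> t) constant_on {0..1}"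
    \<comment> \<open>The common coefficient matrix is the velocity Jacobian evaluated along the
      particle path.\<close>
    by (rule adjoint_system_invariant[where A = "\<lambda>t. velocity_jacobian \<psi> (u t) (Q \<beta> t)"])
      (rule convex_real_interval assms(5,6) | assumption)+
qed

end
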